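(* For every convergent real sequence of boundary data $\{a_m\}_{m\ge 0}$, the solutions of the boundary value problem $$\Delta u=0\ \text{ on }\Omega,\qquad u(q_1)=a_0,\qquad u(x_m)=a_m\ (m\ge 1),$$ that are continuous on $\overline\Omega\setminus\{q_0\}$ form a one-dimensional (affine, one-parameter) family $\{u_\lambda\}_{\lambda\in\mathbb R}$. For a parameter $\lambda\in\mathbb R$, the solution $u_\lambda$ is the harmonic extension to each cell $\overline Y_m$, $m\geq 1$, of the values $u_\lambda(q_1)=a_0$, $u_\lambda(x_m)=a_m$, $u_\lambda(y_1)=\lambda$ and $$u_\lambda(y_m)=3^mF_m(\lambda)+\frac1{5^m}G_m(\lambda),$$ where $$F_m(\lambda)=\frac1{14}\Big(5\lambda-a_0-a_1-18\sum_{k=2}^m\frac1{3^k}a_k\Big),\qquad G_m(\lambda)=\frac1{14}\Big(-5\lambda+15a_0+15a_1+4\sum_{k=2}^m5^ka_k\Big).$$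
   Context: Let $q_0,q_1,q_2$ be the vertices of an equilateral triangle, $F_j(x)=(x+q_j)/2$, and let $SG$ be the Sierpinski gasket, the nonempty compact set with $SG=\bigcup_{j=0}^2F_jSG$. (The maps $F_j$, $j=0,1,2$, are not to be confused with the numbers $F_m(\lambda)$ in the claim.) A cell of level $m$ is $F_{w_1}\cdots F_{w_m}SG$; its boundary points are $F_{w_1}\cdots F_{w_m}q_j$, $j=0,1,2$. Half gasket: $x_m=F_0^{m-1}F_2q_1$ ($m\ge1$), $y_m=F_0^mq_1$ ($m\ge0$, so $y_0=q_1$), $\overline Y_m=F_0^{m-1}F_1SG$ ($m\ge 1$), a level-$m$ cell with boundary points $y_{m-1},y_m,x_m$. Put $X=\{x_m\}_{m\ge1}$, $\overline\Omega=\{q_0\}\cup\bigcup_{m\ge1}\overline Y_m$, $\partial\Omega=\{q_0,q_1\}\cup X$, $\Omega=\overline\Omega\setminus\partial\Omega$. A function on a cell is harmonic if it is the continuous function determined by its values at the three boundary points $v_0,v_1,v_2$ through the harmonic extension algorithm: at the level-one-finer junction point between $v_i$ and $v_j$ it takes the value $(2u(v_i)+2u(v_j)+u(v_k))/5$ ($\{i,j,k\}=\{0,1,2\}$), and this is iterated on all smaller cells. $\Delta$ is the Kigami Laplacian for the standard measure. "$\Delta u=0$ on $\Omega$" means: $u$ is harmonic on each cell $\overline Y_m$, and at each $y_m$, $m\ge1$, the normal derivatives match: $$\Big(\tfrac53\Big)^m[2u(y_m)-u(y_{m-1})-u(x_m)]+\Big(\tfrac53\Big)^{m+1}[2u(y_m)-u(y_{m+1})-u(x_{m+1})]=0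 .$$ No value is prescribed at $q_0$. *)

theory Defs
  imports "HOL-Analysis.Analysis"
begin

text \<open>The vertices of the triangle are \<open>q 0\<close>, \<open>q 1\<close>, \<open>q 2\<close>; other values of \<open>q\<close> are irrelevant.\<close>

definition equilateral :: "(nat \<Rightarrow> real^2) \<Rightarrow> bool" where
  "equilateral q \<longleftrightarrow> q 0 \<noteq> q 1 \<and> dist (q 0) (q 1) = dist (q 1) (q 2)
     \<and> dist (q 1) (q 2) = dist (q 2) (q 0)"

definition contr :: "(nat \<Rightarrow> real^2) \<Rightarrow> nat \<Rightarrow> real^2 \<Rightarrow> real^2" where
  "contr q j x = (1/2) *\<^sub>R (x + q j)"

definition is_gasket :: "(nat \<Rightarrow> real^2) \<Rightarrow> (real^2) set \<Rightarrow> bool" where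
  "is_gasket q K \<longleftrightarrow> K \<noteq> {} \<and> compact K \<and> K = (\<Union>j\<in>{0,1,2}. contr q j ` K)"

definition SG :: "(nat \<Rightarrow> real^2) \<Rightarrow> (real^2) set" where
  "SG q = (THE K. is_gasket q K)"

text \<open>The composition \<open>F\<^sub>w = F\<^bsub>w\<^sub>1\<^esub> \<circ> \<dots> \<circ> F\<^bsub>w\<^sub>m\<^esub>\<close> for \<open>w = [w\<^sub>1, \<dots>, w\<^sub>m]\<close>.\<close>

definition wmap :: "(nat \<Rightarrow> real^2) \<Rightarrow> nat list \<Rightarrow> real^2 \<Rightarrow> real^2" where
  "wmap q w = foldr (contr q) w"

definition cell :: "(nat \<Rightarrow> real^2) \<Rightarrow> nat list \<Rightarrow> (real^2) set" where
  "cell q w = wmap q w ` SG q"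

text \<open>The extension rule is imposed on every subcell \<open>F\<^sub>w F\<^sub>v SG\<close> of \<open>F\<^sub>w SG\<close>; the junction
  point between the corners \<open>i\<close> and \<open>j\<close> of that subcell is \<open>F\<^sub>w F\<^sub>v F\<^sub>i q\<^sub>j = F\<^sub>w F\<^sub>v F\<^sub>j q\<^sub>i\<close>.\<close>

definition harmonic_on_cell ::
    "(nat \<Rightarrow> real^2) \<Rightarrow> nat list \<Rightarrow> (real^2 \<Rightarrow> real) \<Rightarrow> bool" where
  "harmonic_on_cell q w u \<longleftrightarrow> continuous_on (cell q w) u \<and>
     (\<forall>v i j k. set v \<subseteq> {0,1,2} \<and> {i,j,k} = {0,1,2} \<longrightarrow>
        u (wmap q (w @ v) (contr q i (q j))) =
          (2 * u (wmap q (w @ v) (q i)) + 2 * u (wmap q (w @ v) (q j))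
             + u (wmap q (w @ v) (q k))) / 5)"

definition xpt :: "(nat \<Rightarrow> real^2) \<Rightarrow> nat \<Rightarrow> real^2" where
  "xpt q m = (contr q 0 ^^ (m - 1)) (contr q 2 (q 1))"

definition ypt :: "(nat \<Rightarrow> real^2) \<Rightarrow> nat \<Rightarrow> real^2" where
  "ypt q m = (contr q 0 ^^ m) (q 1)"

text \<open>The word of the cell \<open>Y\<^sub>m = F\<^sub>0\<^sup>m\<^sup>-\<^sup>1 F\<^sub>1 SG\<close>, for \<open>m \<ge> 1\<close>.\<close>

definition Yword :: "nat \<Rightarrow> nat list" where
  "Yword m = replicate (m - 1) 0 @ [1]"

definition Omega_closure :: "(nat \<Rightarrow> real^2) \<Rightarrow> (real^2) set" where
  "Omega_closure q = {q 0} \<union> (\<Union>m\<in>{1..}. cell q (Yword m))"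

text \<open>\<open>\<Delta>u = 0\<close> on \<open>\<Omega>\<close>: harmonicity on each cell and matching of normal derivatives at each
  junction \<open>y\<^sub>m\<close>.\<close>

definition Laplace_zero :: "(nat \<Rightarrow> real^2) \<Rightarrow> (real^2 \<Rightarrow> real) \<Rightarrow> bool" where
  "Laplace_zero q u \<longleftrightarrow>
     (\<forall>m\<ge>1. harmonic_on_cell q (Yword m) u) \<and>
     (\<forall>m\<ge>1. (5/3)^m * (2 * u (ypt q m) - u (ypt q (m - 1)) - u (xpt q m))
           + (5/3)^(m+1) * (2 * u (ypt q m) - u (ypt q (m + 1)) - u (xpt q (m + 1))) = 0)"

text \<open>Solutions are functions on \<open>Omega_closure q - {q 0}\<close>; as total functions they are
  normalised to \<open>undefined\<close> elsewhere, so that equality is equality on this domain.\<close>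

definition solutions :: "(nat \<Rightarrow> real^2) \<Rightarrow> (nat \<Rightarrow> real) \<Rightarrow> (real^2 \<Rightarrow> real) set" where
  "solutions q a = {u \<in> extensional (Omega_closure q - {q 0}).
     continuous_on (Omega_closure q - {q 0}) u \<and> Laplace_zero q u \<and>
     u (q 1) = a 0 \<and> (\<forall>m\<ge>1. u (xpt q m) = a m)}"

definition Fcoef :: "(nat \<Rightarrow> real) \<Rightarrow> nat \<Rightarrow> real \<Rightarrow> real" where
  "Fcoef a m l = 1/14 * (5 * l - a 0 - a 1 - 18 * (\<Sum>k=2..m. 1 / 3^k * a k))"

definition Gcoef :: "(nat \<Rightarrow> real) \<Rightarrow> nat \<Rightarrow> real \<Rightarrow> real" where
  "Gcoef a m l = 1/14 * (- 5 * l + 15 * a 0 + 15 * a 1 + 4 * (\<Sum>k=2..m. 5^k * a k))"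


text \<open>The gasket is well defined (Hutchinson).\<close>

lemma gasket_subset:
  assumes A: "is_gasket q A" and B: "is_gasket q B"
  shows "A \<subseteq> B"
proof -
  have cA: "compact A" "A \<noteq> {}" and cB: "closed B" "B \<noteq> {}"
    using A B by (auto simp: is_gasket_def compact_imp_closed)
  have "continuous_on A (\<lambda>x. infdist x B)" by (intro continuous_intros)
  then obtain x0 where x0: "x0 \<in> A" "\<And>x. x \<in> A \<Longrightarrow> infdist x B \<le> infdist x0 B"
    using continuous_attains_sup[OF cA] by blast
  have "x0 \<in> (\<Union>j\<in>{0,1,2}. contr q j ` A)" using A x0(1) unfolding is_gasket_def by blast
  then obtain j x1 where j: "j \<in> {0,1,2}" "x1 \<in> A" "x0 = contr q j x1" by blast
  obtain b where b: "b \<in> B" "infdist x1 B = dist x1 b" using infdist_attains_inf[OF cB] by blast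
  have "contr q j b \<in> (\<Union>j\<in>{0,1,2}. contr q j ` B)" using j(1) b(1) by blast
  then have "contr q j b \<in> B" using B unfolding is_gasket_def by blast
  then have "infdist x0 B \<le> dist (contr q j x1) (contr q j b)" using j(3) by (simp add: infdist_le)
  also have "\<dots> = dist x1 b / 2"
    by (simp add: contr_def dist_norm flip: scaleR_diff_right)
  finally have "infdist x0 B \<le> 0" using b(2) x0(2)[OF j(2)] by simp
  then have "infdist x B = 0" if "x \<in> A" for x
    using x0(2)[OF that] infdist_nonneg[of x B] by linarith
  then show ?thesis using in_closed_iff_infdist_zero[OF cB] by blast
qed

lemma gasket_exists: "\<exists>K. is_gasket q K"
proof -
  define T where "T A = (\<Union>j\<in>{0,1,2}. contr q j ` A)" for A
  define R where "R = norm (q 0) + norm (q 1) + norm (q 2)"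
  define C where "C n = (T ^^ n) (cball 0 R)" for n
  have C_Suc: "C (Suc n) = T (C n)" for n by (simp add: C_def)
  have mono: "A \<subseteq> B \<Longrightarrow> T A \<subseteq> T B" for A B by (auto simp: T_def)
  have "norm (contr q j x) \<le> R" if "j \<in> {0,1,2}" "norm x \<le> R" for j x
  proof -
    have "norm (q j) \<le> R" using that(1) by (auto simp: R_def)
    then show ?thesis using norm_triangle_ineq[of x "q j"] that(2) by (simp add: contr_def)
  qed
  then have "T (C 0) \<subseteq> C 0" by (fastforce simp: C_def T_def)
  then have dec1: "C (Suc n) \<subseteq> C n" for n by (induction n) (simp_all add: C_Suc mono)
  have dec: "C n \<subseteq> C m" if "m \<le> n" for m n
    using that by (induction rule: dec_induct) (use dec1 in auto)
  have comp: "compact (C n) \<and> C n \<noteq> {}" for n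
  proof (induction n)
    case 0 have "0 \<le> R" by (simp add: R_def)
    then show ?case by (simp add: C_def)
  next
    case (Suc n)
    have "compact (contr q j ` C n)" for j
      by (rule compact_continuous_image) (use Suc in \<open>auto simp: contr_def intro!: continuous_intros\<close>)
    then show ?case using Suc by (auto simp: C_Suc T_def)
  qed
  define K where "K = (\<Inter>n. C n)"
  have "K \<noteq> {}" unfolding K_def by (rule compact_nest) (use comp dec in auto)
  moreover have "compact K" unfolding K_def by (rule compact_Inter) (use comp in auto)
  moreover have "T K \<subseteq> K"
  proof -
    have "T K \<subseteq> C (Suc n)" for n unfolding C_Suc by (rule mono) (auto simp: K_def)
    then show ?thesis using dec1 by (force simp: K_def)
  qed
  moreover have "K \<subseteq> T K"
  proof
    fix x assume x: "x \<in> K"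
    define p where "p j = 2 *\<^sub>R x - q j" for j
    have cp: "contr q j (p j) = x" for j by (simp add: contr_def p_def)
    have pc: "p j = y" if "x = contr q j y" for j y
      using that by (simp add: contr_def p_def)
    show "x \<in> T K"
    proof (rule ccontr)
      assume "x \<notin> T K"
      then have "p j \<notin> K" if "j \<in> {0,1,2}" for j using that cp[of j] unfolding T_def by force
      then have "\<forall>j\<in>{0,1,2}. \<exists>n. p j \<notin> C n" by (simp add: K_def)
      then obtain n0 n1 n2 where n: "p 0 \<notin> C n0" "p 1 \<notin> C n1" "p 2 \<notin> C n2" by auto
      define N where "N = n0 + n1 + n2"
      have "x \<in> C (Suc N)" using x by (simp add: K_def)
      then obtain j where "j \<in> {0,1,2}" "p j \<in> C N" using pc by (auto simp: C_Suc T_def)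
      then show False using n dec[of n0 N] dec[of n1 N] dec[of n2 N] by (auto simp: N_def)
    qed
  qed
  ultimately have "is_gasket q K" unfolding is_gasket_def T_def by blast
  then show ?thesis ..
qed

lemma is_gasket_SG: "is_gasket q (SG q)"
  unfolding SG_def
  by (rule theI') (metis gasket_exists gasket_subset subset_antisym)

end

theory Submission
  imports Defs
begin

text \<open>The values \<open>u(y\<^sub>m)\<close> of a solution determine it: on the cell \<open>Y\<^sub>m\<close> it is the harmonic function
  with corner values \<open>u(y\<^sub>m)\<close>, \<open>u(y\<^bsub>m-1\<^esub>)\<close>, \<open>a\<^sub>m\<close>. The matching condition at \<open>y\<^sub>m\<close> is the recurrence
  \<open>5 u(y\<^bsub>m+1\<^esub>) = 16 u(y\<^sub>m) - 3 u(y\<^bsub>m-1\<^esub>) - 3 a\<^sub>m - 5 a\<^bsub>m+1\<^esub>\<close>, whose characteristic roots are \<open>3\<close> and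
  \<open>1/5\<close>. With \<open>u(y\<^sub>0) = a\<^sub>0\<close> given, the only freedom is \<open>u(y\<^sub>1) = \<lambda>\<close>, and variation of constants
  gives the formula with \<open>F\<^sub>m\<close> and \<open>G\<^sub>m\<close> (\<open>junction_value_rec\<close>, \<open>junction_value_unique\<close>).

  What remains is to show that corner values on a cell extend to exactly one harmonic function,
  and that the functions on the cells fit together continuously.

  Uniqueness holds because the extension rule fixes the values at all junction points, and these
  are dense (\<open>harmonic_unique\<close>). For existence it suffices to construct the three harmonic
  functions \<open>h\<^sub>0, h\<^sub>1, h\<^sub>2\<close> on \<open>SG\<close> with \<open>h\<^sub>i(q\<^sub>j) = \<delta>\<^sub>i\<^sub>j\<close>. The extension rule says that
  \<open>H = (h\<^sub>0, h\<^sub>1, h\<^sub>2)\<close> satisfies \<open>H \<circ> F\<^sub>j = M\<^sub>j \<circ> H\<close> for linear maps \<open>M\<^sub>j\<close> of \<open>\<real>\<^sup>3\<close>, so the graph of \<open>H\<close> must be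
  the self-similar set of the maps \<open>F\<^sub>j \<times> M\<^sub>j\<close>. This set is compact, and a compact set that is a graph is the
  graph of a continuous function; so it is enough to see that no two of its points lie above the
  same \<open>x\<close> (\<open>gasket_graph_functional\<close>). That follows from two facts. The maps \<open>M\<^sub>j\<close> shrink
  differences of vectors with equal coordinate sum by the factor \<open>3/5\<close> (\<open>hmap_contraction\<close>). Distinct
  subcells \<open>F\<^sub>jSG\<close>, \<open>F\<^sub>kSG\<close> meet only in \<open>F\<^sub>jq\<^sub>k = F\<^sub>kq\<^sub>j\<close> (\<open>subcells_meet\<close>), where both prescriptions agree.

  The gluing is controlled by one barycentric coordinate \<open>\<beta>\<^sub>0\<close>: the cell \<open>Y\<^sub>m\<close> lies in the slab
  \<open>2\<^sup>-\<^sup>m \<le> 1 - \<beta>\<^sub>0 \<le> 2 \<cdot> 2\<^sup>-\<^sup>m\<close> and touches its lower face only in \<open>y\<^sub>m\<close> (\<open>height_cell\<close>). Therefore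
  different cells share at most a point \<open>y\<^sub>m\<close>, and away from \<open>q\<^sub>0\<close> only finitely many cells come near a
  given point.\<close>

section \<open>The contractions and their compositions\<close>

lemma contr_vertex: "contr q i (q i) = q i"
  by (simp add: contr_def)

lemma contr_commute: "contr q i (q j) = contr q j (q i)"
  by (simp add: contr_def add.commute)

lemma contr_inj: "contr q j x = contr q j y \<longleftrightarrow> x = y"
  by (simp add: contr_def)

lemma wmap_Nil [simp]: "wmap q [] x = x" and
  wmap_Cons [simp]: "wmap q (j # w) x = contr q j (wmap q w x)" and
  wmap_append [simp]: "wmap q (v @ w) x = wmap q v (wmap q w x)"
  by (simp_all add: wmap_def)

section \<open>The graph of the harmonic coordinates\<close>

definition corner :: "nat \<Rightarrow> real \<times> real \<times> real" where
  "corner i = (if i = 0 then (1,0,0) else if i = 1 then (0,1,0) else (0,0,1))"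

text \<open>The map \<open>M\<^sub>j\<close> on values of harmonic coordinates. Its coefficients are the transpose of the
  harmonic extension matrix, which sends corner values on a cell to those on its \<open>j\<close>-th subcell.\<close>

definition hmap :: "nat \<Rightarrow> real \<times> real \<times> real \<Rightarrow> real \<times> real \<times> real" where
  "hmap j z = (case z of (a, b, c) \<Rightarrow>
     if j = 0 then (a + 2/5 * b + 2/5 * c, 2/5 * b + 1/5 * c, 1/5 * b + 2/5 * c)
     else if j = 1 then (2/5 * a + 1/5 * c, b + 2/5 * a + 2/5 * c, 1/5 * a + 2/5 * c)
     else (2/5 * a + 1/5 * b, 1/5 * a + 2/5 * b, c + 2/5 * a + 2/5 * b))"

definition hword :: "nat list \<Rightarrow> real \<times> real \<times> real \<Rightarrow> real \<times> real \<times> real" where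
  "hword w = foldr hmap w"

text \<open>The harmonic coordinates sum to \<open>1\<close>, since constants are harmonic.\<close>

definition mass :: "real \<times> real \<times> real \<Rightarrow> real" where
  "mass z = fst z + fst (snd z) + snd (snd z)"

text \<open>If \<open>z\<close> are the harmonic coordinates of \<open>x\<close>, this is the value at \<open>x\<close> of the harmonic function on
  \<open>SG\<close> with corner values \<open>b\<close>.\<close>

definition pairing :: "(nat \<Rightarrow> real) \<Rightarrow> real \<times> real \<times> real \<Rightarrow> real" where
  "pairing b z = b 0 * fst z + b 1 * fst (snd z) + b 2 * snd (snd z)"

lemma hmap_linear: "linear (hmap j)"
  by (rule linearI) (auto simp: hmap_def algebra_simps split: prod.splits)

lemma hword_linear: "linear (hword w)"
proof (induction w)
  case Nil then show ?case by (simp add: hword_def linear_iff)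
next
  case (Cons j w)
  then show ?case using linear_compose[OF Cons hmap_linear[of j]] by (simp add: hword_def comp_def)
qed

lemma pairing_linear: "linear (pairing b)"
  by (rule linearI) (auto simp: pairing_def algebra_simps)

lemma permutation_012:
  assumes "{i, j, k} = {0, 1, 2::nat}"
  shows "(i,j,k) \<in> {(0,1,2),(0,2,1),(1,0,2),(1,2,0),(2,0,1),(2,1,0)}"
proof -
  have m: "i \<in> {0,1,2}" "j \<in> {0,1,2}" "k \<in> {0,1,2}" using assms by blast+
  have "card {i,j,k} = 3" using assms by simp
  then have "i \<noteq> j" "i \<noteq> k" "j \<noteq> k" by (auto simp: card_insert_if split: if_splits)
  then show ?thesis using m by auto
qed

text \<open>The harmonic extension rule: the junction point \<open>F\<^sub>iq\<^sub>j\<close> receives weights \<open>2/5\<close>, \<open>2/5\<close>, \<open>1/5\<close>.\<close>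

lemma hmap_corner:
  assumes "{i, j, k} = {0, 1, 2::nat}"
  shows "hmap i (corner j) = (1/5) *\<^sub>R (2 *\<^sub>R corner i + 2 *\<^sub>R corner j + corner k)"
  using permutation_012[OF assms] by (auto simp: hmap_def corner_def)

lemma hmap_corner_same: "i \<in> {0,1,2} \<Longrightarrow> hmap i (corner i) = corner i"
  by (auto simp: hmap_def corner_def)

lemma hmap_junction:
  "i \<in> {0,1,2} \<Longrightarrow> j \<in> {0,1,2} \<Longrightarrow> hmap i (corner j) = hmap j (corner i)"
  by (auto simp: hmap_def corner_def)

text \<open>On vectors with sum \<open>0\<close> each \<open>M\<^sub>j\<close> has eigenvalues \<open>3/5\<close> and \<open>1/5\<close> with orthogonal eigenvectors, hence
  Euclidean norm \<open>3/5\<close>. The remaining eigenvalue \<open>1\<close> belongs to the corner \<open>e\<^sub>j\<close>, which is why the sums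
  must agree.\<close>

lemma hmap_contraction:
  assumes "mass z = mass z'"
  shows "dist (hmap j z) (hmap j z') \<le> 3/5 * dist z z'"
proof -
  obtain a b c where d: "z - z' = (a, b, c)" using prod_cases3 by blast
  have s: "a + b + c = 0" using assms d by (cases z; cases z') (auto simp: mass_def)
  have *: "25 * (norm (hmap j (a,b,c)))\<^sup>2 \<le> 9 * (norm (a,b,c))\<^sup>2"
  proof -
    have "(x + 2/5*y + 2/5*t)\<^sup>2 * 25 + (2/5*y + 1/5*t)\<^sup>2 * 25 + (1/5*y + 2/5*t)\<^sup>2 * 25
        \<le> 9 * x\<^sup>2 + 9 * y\<^sup>2 + 9 * t\<^sup>2" if "x + y + t = 0" for x y t :: real
    proof -
      have x: "x = - y - t" using that by simp
      \<comment> \<open>With \<open>x = - y - t\<close> the right side exceeds the left one by exactly this square.\<close>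
      have "0 \<le> 4 * (y - t)\<^sup>2" by simp
      then show ?thesis unfolding x by (simp add: power2_eq_square algebra_simps)
    qed
    \<comment> \<open>The three maps differ only by a permutation of the coordinates.\<close>
    from this[of a b c] this[of b a c] this[of c a b] s show ?thesis
      by (simp add: hmap_def norm_Pair algebra_simps)
  qed
  have "(norm (hmap j (a,b,c)))\<^sup>2 \<le> (3/5 * norm (a,b,c))\<^sup>2"
    using * by (simp add: power_mult_distrib power_divide)
  then have "norm (hmap j (a,b,c)) \<le> 3/5 * norm (a,b,c)"
    by (rule power2_le_imp_le) simp
  then show ?thesis
    by (simp add: dist_norm d[symmetric] linear_diff[OF hmap_linear])
qed

definition graph_step ::
    "(nat \<Rightarrow> real^2) \<Rightarrow> nat \<Rightarrow> (real^2) \<times> real \<times> real \<times> real \<Rightarrow> (real^2) \<times> real \<times> real \<times> real" where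
  "graph_step q j p = (contr q j (fst p), hmap j (snd p))"

text \<open>The part of the graph that the extension rule forces directly.\<close>

definition vertex_graph :: "(nat \<Rightarrow> real^2) \<Rightarrow> ((real^2) \<times> real \<times> real \<times> real) set" where
  "vertex_graph q = {(wmap q w (q i), hword w (corner i)) | w i. set w \<subseteq> {0,1,2} \<and> i \<in> {0,1,2}}"

definition gasket_graph :: "(nat \<Rightarrow> real^2) \<Rightarrow> ((real^2) \<times> real \<times> real \<times> real) set" where
  "gasket_graph q = closure (vertex_graph q)"

lemma hword_Nil [simp]: "hword [] z = z" and
  hword_Cons [simp]: "hword (j # w) z = hmap j (hword w z)"
  by (simp_all add: hword_def)

lemma vertex_graphI:
  "set w \<subseteq> {0,1,2} \<Longrightarrow> i \<in> {0,1,2} \<Longrightarrow> (wmap q w (q i), hword w (corner i)) \<in> vertex_graph q"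
  unfolding vertex_graph_def by blast

text \<open>The words of positive length account for the right-hand side; the empty word adds nothing because
  \<open>q\<^sub>i\<close> and \<open>e\<^sub>i\<close> are fixed by \<open>F\<^sub>i\<close> and \<open>M\<^sub>i\<close>.\<close>

lemma vertex_graph_selfsimilar: "vertex_graph q = (\<Union>j\<in>{0,1,2}. graph_step q j ` vertex_graph q)"
proof
  show "vertex_graph q \<subseteq> (\<Union>j\<in>{0,1,2}. graph_step q j ` vertex_graph q)"
  proof
    fix p assume "p \<in> vertex_graph q"
    then obtain w i where w: "set w \<subseteq> {0,1,2}" and i: "i \<in> {0,1,2}"
      and p: "p = (wmap q w (q i), hword w (corner i))" unfolding vertex_graph_def by blast
    have in_image: "(wmap q (j # v) (q i), hword (j # v) (corner i)) \<in>
        (\<Union>j\<in>{0,1,2}. graph_step q j ` vertex_graph q)" if "set (j # v) \<subseteq> {0,1,2}" for j v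
    proof (rule UN_I)
      show "j \<in> {0,1,2}" using that by simp
      have "(wmap q v (q i), hword v (corner i)) \<in> vertex_graph q"
        by (rule vertex_graphI[OF _ i]) (use that in simp)
      then show "(wmap q (j # v) (q i), hword (j # v) (corner i)) \<in> graph_step q j ` vertex_graph q"
        by (rule rev_image_eqI) (simp add: graph_step_def)
    qed
    show "p \<in> (\<Union>j\<in>{0,1,2}. graph_step q j ` vertex_graph q)"
    proof (cases w)
      case Nil
      then have "p = (wmap q [i] (q i), hword [i] (corner i))"
        by (simp only: p wmap_Cons hword_Cons wmap_Nil hword_Nil contr_vertex hmap_corner_same[OF i])
      moreover have "set [i] \<subseteq> {0,1,2}" using i by simp
      ultimately show ?thesis using in_image[of i "[]"] by (simp only:)
    next
      case (Cons j v)
      then show ?thesis using in_image[of j v] w unfolding p by (simp only:)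
    qed
  qed
next
  have "graph_step q j p \<in> vertex_graph q" if p: "p \<in> vertex_graph q" and j: "j \<in> {0,1,2}" for j p
  proof -
    obtain w i where w: "set w \<subseteq> {0,1,2}" and i: "i \<in> {0,1,2}"
      and p: "p = (wmap q w (q i), hword w (corner i))" using p unfolding vertex_graph_def by blast
    have "graph_step q j p = (wmap q (j # w) (q i), hword (j # w) (corner i))"
      by (simp add: p graph_step_def)
    also have "\<dots> \<in> vertex_graph q" by (rule vertex_graphI[OF _ i]) (use w j in simp)
    finally show ?thesis .
  qed
  then show "(\<Union>j\<in>{0,1,2}. graph_step q j ` vertex_graph q) \<subseteq> vertex_graph q" by blast
qed

text \<open>The \<open>M\<^sub>j\<close> preserve the simplex of probability vectors, which keeps the graph bounded.\<close>

lemma hword_corner_simplex: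
  assumes "i \<in> {0,1,2}"
  shows "mass (hword w (corner i)) = 1 \<and> hword w (corner i) \<in> {0..} \<times> {0..} \<times> {0..}"
proof (induction w)
  case Nil then show ?case using assms by (auto simp: corner_def mass_def)
next
  case (Cons j w)
  then show ?case
    by (cases "hword w (corner i)") (auto simp: mass_def hmap_def)
qed

lemma bounded_vertex_graph: "bounded (vertex_graph q)"
proof (rule bounded_subset)
  define R where "R = norm (q 0) + norm (q 1) + norm (q 2)"
  show "bounded (cball (0::real^2) R \<times> {0..1::real} \<times> {0..1::real} \<times> {0..1::real})"
    by (intro bounded_Times bounded_cball bounded_closed_interval)
  have qR: "norm (q i) \<le> R" if "i \<in> {0,1,2}" for i using that by (auto simp: R_def)
  have 1: "norm (wmap q w (q i)) \<le> R" if "set w \<subseteq> {0,1,2}" "i \<in> {0,1,2}" for w i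
    using that
  proof (induction w)
    case (Cons j w)
    then have "norm (wmap q w (q i)) \<le> R" "norm (q j) \<le> R" using qR by auto
    then show ?case using norm_triangle_ineq[of "wmap q w (q i)" "q j"] by (simp add: contr_def)
  qed (use qR in auto)
  have 2: "hword w (corner i) \<in> {0..1} \<times> {0..1} \<times> {0..1}" if "i \<in> {0,1,2}" for w i
    using hword_corner_simplex[OF that, of w]
    by (cases "hword w (corner i)") (auto simp: mass_def)
  show "vertex_graph q \<subseteq> cball 0 R \<times> {0..1} \<times> {0..1} \<times> {0..1}"
  proof
    fix p assume "p \<in> vertex_graph q"
    then obtain w i where "set w \<subseteq> {0,1,2}" "i \<in> {0,1,2}"
      and p: "p = (wmap q w (q i), hword w (corner i))" unfolding vertex_graph_def by blast
    then show "p \<in> cball 0 R \<times> {0..1} \<times> {0..1} \<times> {0..1}"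
      unfolding p by (intro SigmaI mem_cball_0[THEN iffD2] 1 2)
  qed
qed

lemma compact_gasket_graph: "compact (gasket_graph q)"
  unfolding gasket_graph_def compact_closure by (rule bounded_vertex_graph)

lemma gasket_graph_selfsimilar: "gasket_graph q = (\<Union>j\<in>{0,1,2}. graph_step q j ` gasket_graph q)"
proof -
  have cont: "continuous_on A (graph_step q j)" for A j
    unfolding graph_step_def contr_def
    by (intro continuous_intros linear_continuous_on_compose[OF _ hmap_linear])
  have "closure (graph_step q j ` vertex_graph q) = graph_step q j ` gasket_graph q" for j
  proof
    have "compact (graph_step q j ` gasket_graph q)"
      by (intro compact_continuous_image cont compact_gasket_graph)
    then show "closure (graph_step q j ` vertex_graph q) \<subseteq> graph_step q j ` gasket_graph q"
      using closure_subset[of "vertex_graph q"]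
      by (intro closure_minimal image_mono compact_imp_closed) (auto simp: gasket_graph_def)
    show "graph_step q j ` gasket_graph q \<subseteq> closure (graph_step q j ` vertex_graph q)"
      unfolding gasket_graph_def
      by (rule image_closure_subset[OF cont closed_closure closure_subset])
  qed
  then have 1: "(\<Union>j\<in>{0,1,2}. closure (graph_step q j ` vertex_graph q))
      = (\<Union>j\<in>{0,1,2}. graph_step q j ` gasket_graph q)" by (simp only:)
  have "gasket_graph q = (\<Union>j\<in>{0,1,2}. closure (graph_step q j ` vertex_graph q))"
    unfolding gasket_graph_def by (subst vertex_graph_selfsimilar) simp
  then show ?thesis using 1 by (rule trans)
qed

lemma corner_graph:
  assumes "i \<in> {0,1,2}"
  shows "(q i, corner i) \<in> gasket_graph q"
proof -
  have "(wmap q [] (q i), hword [] (corner i)) \<in> vertex_graph q"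
    by (rule vertex_graphI[OF _ assms]) simp
  then show ?thesis
    unfolding gasket_graph_def wmap_Nil hword_Nil by (rule subsetD[OF closure_subset])
qed

text \<open>The projection is a gasket, and the gasket is unique.\<close>

lemma fst_gasket_graph: "fst ` gasket_graph q = SG q"
proof (rule antisym)
  have ne: "fst ` gasket_graph q \<noteq> {}" using corner_graph[of 0 q] by auto
  have c: "compact (fst ` gasket_graph q)"
    by (intro compact_continuous_image compact_gasket_graph continuous_intros)
  have img: "fst ` graph_step q j ` A = contr q j ` fst ` A" for j A
    by (simp add: graph_step_def image_image)
  have "fst ` gasket_graph q = (\<Union>j\<in>{0,1,2}. contr q j ` fst ` gasket_graph q)"
    by (subst gasket_graph_selfsimilar) (simp only: image_UN img)
  then have "is_gasket q (fst ` gasket_graph q)"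
    unfolding is_gasket_def using ne c by (intro conjI)
  then show "fst ` gasket_graph q \<subseteq> SG q" "SG q \<subseteq> fst ` gasket_graph q"
    using gasket_subset is_gasket_SG by blast+
qed

text \<open>The points \<open>F\<^sub>wq\<^sub>i\<close> are dense in \<open>SG\<close>, in the form of a proof rule for closed properties.\<close>

lemma SG_subset_closed:
  assumes "closed C"
    and vertex: "\<And>w i. set w \<subseteq> {0,1,2} \<Longrightarrow> i \<in> {0,1,2} \<Longrightarrow> wmap q w (q i) \<in> C"
  shows "SG q \<subseteq> C"
proof -
  have "vertex_graph q \<subseteq> fst -` C"
  proof
    fix p assume "p \<in> vertex_graph q"
    then obtain w i where w: "set w \<subseteq> {0,1,2}" "i \<in> {0,1,2}"
      and p: "p = (wmap q w (q i), hword w (corner i))" unfolding vertex_graph_def by blast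
    show "p \<in> fst -` C" using vertex[OF w] by (simp add: p)
  qed
  then have "gasket_graph q \<subseteq> fst -` C"
    unfolding gasket_graph_def using assms(1) by (intro closure_minimal closed_vimage_fst)
  then show ?thesis unfolding fst_gasket_graph[symmetric] by (simp add: image_subset_iff_subset_vimage)
qed

lemma gasket_graph_step:
  assumes "j \<in> {0,1,2}" "(y, s) \<in> gasket_graph q"
  shows "(contr q j y, hmap j s) \<in> gasket_graph q"
proof -
  have "graph_step q j (y, s) \<in> (\<Union>j\<in>{0,1,2}. graph_step q j ` gasket_graph q)"
    by (rule UN_I[OF assms(1) imageI[OF assms(2)]])
  then show ?thesis by (subst gasket_graph_selfsimilar) (simp only: graph_step_def fst_conv snd_conv)
qed

lemma gasket_graph_cases:
  assumes "(x, z) \<in> gasket_graph q"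
  obtains j y s where "j \<in> {0,1,2}" "(y, s) \<in> gasket_graph q" "y \<in> SG q"
    "x = contr q j y" "z = hmap j s"
proof -
  have "(x, z) \<in> (\<Union>j\<in>{0,1,2}. graph_step q j ` gasket_graph q)"
    using assms by (subst (asm) gasket_graph_selfsimilar)
  then obtain j p where j: "j \<in> {0,1,2}" and p: "p \<in> gasket_graph q" "(x, z) = graph_step q j p"
    by (elim UN_E imageE)
  show thesis
  proof (rule that[OF j])
    show "(fst p, snd p) \<in> gasket_graph q" using p(1) by simp
    show "fst p \<in> SG q" unfolding fst_gasket_graph[symmetric] using p(1) by (rule imageI)
  qed (use p(2) in \<open>simp_all add: graph_step_def\<close>)
qed

lemma contr_SG:
  assumes "j \<in> {0,1,2}" "x \<in> SG q"
  shows "contr q j x \<in> SG q"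
proof -
  have "contr q j x \<in> (\<Union>j\<in>{0,1,2}. contr q j ` SG q)" using assms by blast
  then show ?thesis using is_gasket_SG[of q] unfolding is_gasket_def by blast
qed

lemma wmap_SG: "set w \<subseteq> {0,1,2} \<Longrightarrow> x \<in> SG q \<Longrightarrow> wmap q w x \<in> SG q"
  by (induction w) (simp_all add: contr_SG)

lemma q_SG: "i \<in> {0,1,2} \<Longrightarrow> q i \<in> SG q"
  by (metis corner_graph fst_conv fst_gasket_graph image_eqI)

lemma gasket_graph_mass: "p \<in> gasket_graph q \<Longrightarrow> mass (snd p) = 1"
proof -
  have "gasket_graph q \<subseteq> {p. mass (snd p) = 1}"
    unfolding gasket_graph_def
  proof (rule closure_minimal)
    show "vertex_graph q \<subseteq> {p. mass (snd p) = 1}"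
      unfolding vertex_graph_def using hword_corner_simplex by auto
    show "closed {p :: (real^2) \<times> real \<times> real \<times> real. mass (snd p) = 1}"
      unfolding mass_def by (intro closed_Collect_eq continuous_intros)
  qed
  then show "p \<in> gasket_graph q \<Longrightarrow> mass (snd p) = 1" by blast
qed

section \<open>Barycentric coordinates\<close>

text \<open>For an equilateral triangle the \<open>i\<close>-th barycentric coordinate is an affine function with gradient
  along the median \<open>3 q\<^sub>i - (q\<^sub>0 + q\<^sub>1 + q\<^sub>2)\<close>; its scalar product with an edge \<open>q\<^sub>i - q\<^sub>j\<close> is \<open>3/2\<close> times the
  squared side length.\<close>

definition bary :: "(nat \<Rightarrow> real^2) \<Rightarrow> nat \<Rightarrow> real^2 \<Rightarrow> real" where
  "bary q i x = 1 - 2 / (3 * (dist (q 0) (q 1))\<^sup>2) * ((q i - x) \<bullet> (3 *\<^sub>R q i - q 0 - q 1 - q 2))"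

lemma bary_affine:
  assumes "s + t + r = 1"
  shows "bary q i (s *\<^sub>R x + t *\<^sub>R y + r *\<^sub>R z) = s * bary q i x + t * bary q i y + r * bary q i z"
proof -
  define n where "n = 3 *\<^sub>R q i - q 0 - q 1 - q 2"
  define c where "c = 2 / (3 * (dist (q 0) (q 1))\<^sup>2)"
  have r: "r = 1 - s - t" using assms by simp
  show ?thesis unfolding bary_def n_def[symmetric] c_def[symmetric] r
    by (simp add: inner_diff_left inner_add_left algebra_simps)
qed

lemma bary_vertex:
  assumes "equilateral q" "i \<in> {0,1,2}" "j \<in> {0,1,2}"
  shows "bary q i (q j) = (if i = j then 1 else 0)"
proof -
  define s where "s = (dist (q 0) (q 1))\<^sup>2"
  have s: "s > 0" using assms(1) by (auto simp: s_def equilateral_def)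
  have d: "(q 0 - q 1) \<bullet> (q 0 - q 1) = s" "(q 1 - q 2) \<bullet> (q 1 - q 2) = s"
      "(q 2 - q 0) \<bullet> (q 2 - q 0) = s"
    using assms(1) by (simp_all add: s_def equilateral_def dist_norm power2_norm_eq_inner[symmetric])
  have key: "(q i - q j) \<bullet> (3 *\<^sub>R q i - q 0 - q 1 - q 2) = (if i = j then 0 else 3/2 * s)"
    using d assms(2,3)
    by (auto simp: inner_diff_left inner_diff_right inner_commute algebra_simps)
  show ?thesis unfolding bary_def key s_def[symmetric] using s by simp
qed

lemma bary_contr:
  assumes "equilateral q" "i \<in> {0,1,2}" "j \<in> {0,1,2}"
  shows "bary q i (contr q j x) = (bary q i x + (if i = j then 1 else 0)) / 2"
  using bary_affine[of "1/2" "1/2" 0 q i x "q j" 0] bary_vertex[OF assms]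
  by (simp add: contr_def scaleR_add_right)

lemma SG_convex_hull: "SG q \<subseteq> convex hull {q 0, q 1, q 2}"
proof -
  have "wmap q w (q i) \<in> convex hull {q 0, q 1, q 2}" if "set w \<subseteq> {0,1,2}" "i \<in> {0,1,2}" for w i
    using that
  proof (induction w)
    case Nil then show ?case by (auto intro: hull_inc)
  next
    case (Cons j w)
    then have "wmap q w (q i) \<in> convex hull {q 0, q 1, q 2}" "q j \<in> convex hull {q 0, q 1, q 2}"
      by (auto intro: hull_inc)
    then have "(1/2) *\<^sub>R wmap q w (q i) + (1/2) *\<^sub>R q j \<in> convex hull {q 0, q 1, q 2}"
      by (intro convexD[OF convex_convex_hull]) auto
    then show ?case by (simp add: contr_def scaleR_add_right)
  qed
  then show ?thesis
    by (intro SG_subset_closed compact_imp_closed finite_imp_compact_convex_hull) simp_all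
qed

lemma bary_SG:
  assumes "equilateral q" "i \<in> {0,1,2}" "x \<in> SG q"
  shows "0 \<le> bary q i x" "bary q i x \<le> 1" "bary q i x = 1 \<Longrightarrow> x = q i"
proof -
  have "x \<in> convex hull {q 0, q 1, q 2}" using SG_convex_hull assms(3) by blast
  then obtain s t r where str: "s \<ge> 0" "t \<ge> 0" "r \<ge> 0" "s + t + r = 1"
    and x: "x = s *\<^sub>R q 0 + t *\<^sub>R q 1 + r *\<^sub>R q 2"
    unfolding convex_hull_3 by blast
  have "bary q i x = s * bary q i (q 0) + t * bary q i (q 1) + r * bary q i (q 2)"
    unfolding x by (rule bary_affine[OF str(4)])
  also have "\<dots> = (if i = 0 then s else if i = 1 then t else r)"
    using assms(2) bary_vertex[OF assms(1,2)] by auto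
  finally have b: "bary q i x = (if i = 0 then s else if i = 1 then t else r)" .
  show "0 \<le> bary q i x" "bary q i x \<le> 1" using b str by auto
  assume "bary q i x = 1"
  then have "(if i = 0 then s else if i = 1 then t else r) = 1" using b by simp
  then have "s = (if i = 0 then 1 else 0) \<and> t = (if i = 1 then 1 else 0) \<and> r = (if i = 2 then 1 else 0)"
    using str assms(2) by (auto split: if_splits)
  then show "x = q i" using x assms(2) by auto
qed

text \<open>A common point has \<open>k\<close>-th coordinate at most \<open>1/2\<close> as a point of the \<open>j\<close>-th subcell and at least
  \<open>1/2\<close> as a point of the \<open>k\<close>-th one. Equality forces the coordinate of \<open>y\<close> to be \<open>1\<close>.\<close>

lemma subcells_meet:
  assumes "equilateral q" "j \<in> {0,1,2}" "k \<in> {0,1,2}" "j \<noteq> k"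
    and "y \<in> SG q" "y' \<in> SG q" "contr q j y = contr q k y'"
  shows "y = q k"
proof -
  have "bary q k y / 2 = (bary q k y' + 1) / 2"
    using bary_contr[OF assms(1,3,2), of y] bary_contr[OF assms(1,3,3), of y'] assms(4,7) by simp
  then have "bary q k y = 1"
    using bary_SG(2)[OF assms(1,3,5)] bary_SG(1)[OF assms(1,3,6)] by simp
  then show ?thesis by (rule bary_SG(3)[OF assms(1,3,5)])
qed

section \<open>Harmonic coordinates and harmonic extension\<close>

text \<open>The supremum \<open>D\<close> of \<open>f\<close> satisfies \<open>D \<le> max 0 (3/5 D)\<close>. With \<open>f\<close> a distance in the graph, this draws the
  conclusion of infinitely many subdivisions from a single one.\<close>

lemma self_improving_bound:
  fixes f :: "'a \<Rightarrow> real"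
  assumes "bdd_above (f ` A)" "p \<in> A"
    and step: "\<And>p. p \<in> A \<Longrightarrow> f p \<le> 0 \<or> (\<exists>p'\<in>A. f p \<le> 3/5 * f p')"
  shows "f p \<le> 0"
proof -
  define D where "D = Sup (f ` A)"
  have up: "f p \<le> D" if "p \<in> A" for p
    unfolding D_def using assms(1) that by (simp add: cSUP_upper)
  have "f p \<le> max 0 (3/5 * D)" if "p \<in> A" for p
    using step[OF that]
  proof
    assume "\<exists>p'\<in>A. f p \<le> 3/5 * f p'"
    then obtain p' where "p' \<in> A" "f p \<le> 3/5 * f p'" by blast
    then show ?thesis using up[of p'] by simp
  qed simp
  then have "D \<le> max 0 (3/5 * D)"
    unfolding D_def using assms(2) by (intro cSUP_least) auto
  then show ?thesis using up[OF assms(2)] by linarith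
qed

lemma gasket_graph_dist_bdd:
  "bdd_above ((\<lambda>(z, z'). dist z z') ` (snd ` gasket_graph q \<times> snd ` gasket_graph q))"
proof -
  have "bounded (snd ` gasket_graph q)"
    by (intro compact_imp_bounded compact_continuous_image compact_gasket_graph continuous_intros)
  then obtain e where "\<forall>z\<in>snd ` gasket_graph q. \<forall>z'\<in>snd ` gasket_graph q. dist z z' \<le> e"
    unfolding bounded_two_points by blast
  then show ?thesis by (intro bdd_aboveI2[of _ _ e]) (metis mem_Times_iff split_beta)
qed

text \<open>The point \<open>q\<^sub>k\<close> lies in no subcell except the \<open>k\<close>-th, and there only as the image of itself. So the
  fibre above \<open>q\<^sub>k\<close> is mapped onto itself by \<open>M\<^sub>k\<close>, which contracts it towards \<open>e\<^sub>k\<close>.\<close>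

lemma gasket_graph_corner:
  assumes eq: "equilateral q" and k: "k \<in> {0,1,2}" and "(q k, z) \<in> gasket_graph q"
  shows "z = corner k"
proof -
  define A where "A = {z. (q k, z) \<in> gasket_graph q}"
  have "(\<lambda>(z, z'). dist z z') ` (A \<times> {corner k}) \<subseteq>
      (\<lambda>(z, z'). dist z z') ` (snd ` gasket_graph q \<times> snd ` gasket_graph q)"
    using corner_graph[OF k, of q] unfolding A_def
    by (intro image_mono Sigma_mono) (auto intro: rev_image_eqI)
  then have "(\<lambda>z. dist z (corner k)) ` A \<subseteq>
      (\<lambda>(z, z'). dist z z') ` (snd ` gasket_graph q \<times> snd ` gasket_graph q)" by auto
  then have bdd: "bdd_above ((\<lambda>z. dist z (corner k)) ` A)"
    by (rule bdd_above_mono[OF gasket_graph_dist_bdd])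
  have "dist z (corner k) \<le> 0"
  proof (rule self_improving_bound[OF bdd])
    show "z \<in> A" using assms(3) by (simp add: A_def)
    fix s assume s: "s \<in> A"
    then have "(q k, s) \<in> gasket_graph q" by (simp add: A_def)
    then obtain j y t where j: "j \<in> {0,1,2}" and t: "(y, t) \<in> gasket_graph q"
      and y: "y \<in> SG q" and qk: "q k = contr q j y" and s': "s = hmap j t"
      by (rule gasket_graph_cases)
    have "j = k"
      using bary_contr[OF eq k j, of y] bary_vertex[OF eq k k] bary_SG(2)[OF eq k y] qk
      by (simp split: if_splits)
    then have "y = q k" using qk contr_vertex[of q k] contr_inj by metis
    then have "t \<in> A" using t by (simp add: A_def)
    moreover have "dist s (corner k) \<le> 3/5 * dist t (corner k)"
      using hmap_contraction[of t "corner k" k] hmap_corner_same[OF k] \<open>j = k\<close> s'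
        gasket_graph_mass[OF t] gasket_graph_mass[OF corner_graph[OF k, of q]] by simp
    ultimately show "dist s (corner k) \<le> 0 \<or> (\<exists>s'\<in>A. dist s (corner k) \<le> 3/5 * dist s' (corner k))"
      by blast
  qed
  then show ?thesis by simp
qed

text \<open>Two points above \<open>x\<close> come either from a common subcell, and then from two points above one \<open>y\<close> that
  are \<open>5/3\<close> times as far apart, or from two subcells meeting at \<open>x\<close>, and then \<open>x\<close> is a junction point
  whose fibre is known from the corners.\<close>

lemma gasket_graph_functional:
  assumes eq: "equilateral q" and "(x, z) \<in> gasket_graph q" "(x, z') \<in> gasket_graph q"
  shows "z = z'"
proof -
  define A where "A = {(z, z'). \<exists>x. (x, z) \<in> gasket_graph q \<and> (x, z') \<in> gasket_graph q}"
  have "(\<lambda>(z, z'). dist z z') ` A \<subseteq>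
      (\<lambda>(z, z'). dist z z') ` (snd ` gasket_graph q \<times> snd ` gasket_graph q)"
    unfolding A_def by (intro image_mono) force
  then have bdd: "bdd_above ((\<lambda>(z, z'). dist z z') ` A)"
    by (rule bdd_above_mono[OF gasket_graph_dist_bdd])
  have "(case (z, z') of (z, z') \<Rightarrow> dist z z') \<le> 0"
  proof (rule self_improving_bound[OF bdd])
    show "(z, z') \<in> A" using assms(2,3) by (auto simp: A_def)
    fix p assume "p \<in> A"
    then obtain x s s' where ss: "p = (s, s')" "(x, s) \<in> gasket_graph q" "(x, s') \<in> gasket_graph q"
      by (auto simp: A_def)
    obtain j y t where j: "j \<in> {0,1,2}" and t: "(y, t) \<in> gasket_graph q"
      and y: "y \<in> SG q" and x: "x = contr q j y" and s: "s = hmap j t"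
      using ss(2) by (rule gasket_graph_cases)
    obtain k y' t' where k: "k \<in> {0,1,2}" and t': "(y', t') \<in> gasket_graph q"
      and y': "y' \<in> SG q" and x': "x = contr q k y'" and s': "s' = hmap k t'"
      using ss(3) by (rule gasket_graph_cases)
    have xx: "contr q j y = contr q k y'" using x x' by simp
    show "(case p of (z, z') \<Rightarrow> dist z z') \<le> 0 \<or>
        (\<exists>p'\<in>A. (case p of (z, z') \<Rightarrow> dist z z') \<le> 3/5 * (case p' of (z, z') \<Rightarrow> dist z z'))"
    proof (cases "j = k")
      case True
      then have "y = y'" using xx by (simp add: contr_inj)
      then have "(t, t') \<in> A" using t t' unfolding A_def by blast
      moreover have "dist s s' \<le> 3/5 * dist t t'"
        unfolding s s' True
        using gasket_graph_mass[OF t] gasket_graph_mass[OF t'] by (intro hmap_contraction) simp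
      ultimately show ?thesis using ss(1) by (intro disjI2 bexI[of _ "(t, t')"]) auto
    next
      case False
      have "y = q k" using subcells_meet[OF eq j k False y y' xx] .
      then have "t = corner k" using gasket_graph_corner[OF eq k] t by simp
      moreover have "y' = q j" using subcells_meet[OF eq k j False[symmetric] y' y xx[symmetric]] .
      then have "t' = corner j" using gasket_graph_corner[OF eq j] t' by simp
      ultimately have "s = s'" using s s' hmap_junction[OF j k] by simp
      then show ?thesis using ss(1) by simp
    qed
  qed
  then show ?thesis by simp
qed

text \<open>The harmonic coordinate map \<open>H\<close>, well determined on \<open>SG\<close> for an equilateral triangle by
  \<open>gasket_graph_functional\<close>.\<close>

definition hcoord :: "(nat \<Rightarrow> real^2) \<Rightarrow> real^2 \<Rightarrow> real \<times> real \<times> real" where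
  "hcoord q x = (SOME z. (x, z) \<in> gasket_graph q)"

lemma hcoord_graph: "x \<in> SG q \<Longrightarrow> (x, hcoord q x) \<in> gasket_graph q"
proof -
  assume "x \<in> SG q"
  then have "\<exists>z. (x, z) \<in> gasket_graph q" using fst_gasket_graph[of q] by force
  then show ?thesis unfolding hcoord_def by (rule someI_ex)
qed

lemma hcoord_eqI: "equilateral q \<Longrightarrow> (x, z) \<in> gasket_graph q \<Longrightarrow> hcoord q x = z"
  by (metis gasket_graph_functional hcoord_def someI)

lemma hcoord_vertex: "equilateral q \<Longrightarrow> i \<in> {0,1,2} \<Longrightarrow> hcoord q (q i) = corner i"
  by (intro hcoord_eqI corner_graph)

lemma hcoord_contr:
  assumes "equilateral q" "j \<in> {0,1,2}" "x \<in> SG q"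
  shows "hcoord q (contr q j x) = hmap j (hcoord q x)"
proof (rule hcoord_eqI[OF assms(1)])
  show "(contr q j x, hmap j (hcoord q x)) \<in> gasket_graph q"
    by (rule gasket_graph_step[OF assms(2) hcoord_graph[OF assms(3)]])
qed

lemma hcoord_wmap:
  assumes "equilateral q" "set w \<subseteq> {0,1,2}" "x \<in> SG q"
  shows "hcoord q (wmap q w x) = hword w (hcoord q x)"
  using assms(2) by (induction w) (auto simp: hcoord_contr[OF assms(1)] wmap_SG assms(3))

text \<open>The projection of the compact graph to \<open>SG\<close> is a continuous bijection, so its inverse
  \<open>x \<mapsto> (x, H x)\<close> is continuous.\<close>

lemma continuous_on_hcoord:
  assumes "equilateral q"
  shows "continuous_on (SG q) (hcoord q)"
proof -
  have "continuous_on (fst ` gasket_graph q) (\<lambda>x. (x, hcoord q x))"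
    by (rule continuous_on_inv)
      (auto intro!: compact_gasket_graph continuous_intros hcoord_eqI[OF assms])
  then have "continuous_on (SG q) (\<lambda>x. snd (x, hcoord q x))"
    unfolding fst_gasket_graph by (rule continuous_on_snd)
  then show ?thesis by simp
qed

lemma wmap_inj: "wmap q w x = wmap q w y \<longleftrightarrow> x = y"
  by (induction w) (simp_all add: contr_inj)

lemma continuous_on_wmap: "continuous_on A (wmap q w)"
proof (induction w)
  case Nil then show ?case by (simp add: wmap_def)
next
  case (Cons j w)
  then have "continuous_on A (\<lambda>x. contr q j (wmap q w x))"
    unfolding contr_def by (intro continuous_intros)
  then show ?case by (simp flip: wmap_Cons)
qed

text \<open>The extension of corner values \<open>b\<close> from the cell \<open>F\<^sub>wSG\<close>, transported from \<open>SG\<close> by \<open>F\<^sub>w\<close>.\<close>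

definition harmonic_extension ::
    "(nat \<Rightarrow> real^2) \<Rightarrow> nat list \<Rightarrow> (nat \<Rightarrow> real) \<Rightarrow> real^2 \<Rightarrow> real" where
  "harmonic_extension q w b z = pairing b (hcoord q (inv (wmap q w) z))"

lemma harmonic_extension_wmap:
  "harmonic_extension q w b (wmap q w x) = pairing b (hcoord q x)"
proof -
  have "inj (wmap q w)" by (rule injI) (simp add: wmap_inj)
  then show ?thesis by (simp add: harmonic_extension_def)
qed

lemma harmonic_extension_corner:
  assumes "equilateral q" "i \<in> {0,1,2}"
  shows "harmonic_extension q w b (wmap q w (q i)) = b i"
  using assms(2)
  by (auto simp: harmonic_extension_wmap hcoord_vertex[OF assms(1)] pairing_def corner_def)

lemma harmonic_extension_affine:
  assumes "\<And>i. i \<in> {0,1,2} \<Longrightarrow> b i = s * b' i + t * b'' i"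
  shows "harmonic_extension q w b z = s * harmonic_extension q w b' z + t * harmonic_extension q w b'' z"
  using assms by (simp add: harmonic_extension_def pairing_def algebra_simps)

lemma harmonic_on_cell_cong:
  assumes u: "harmonic_on_cell q w u" and eq: "\<And>z. z \<in> cell q w \<Longrightarrow> u' z = u z"
  shows "harmonic_on_cell q w u'"
  unfolding harmonic_on_cell_def
proof (intro conjI allI impI)
  have "continuous_on (cell q w) u' \<longleftrightarrow> continuous_on (cell q w) u"
    by (rule continuous_on_cong) (simp_all add: eq)
  then show "continuous_on (cell q w) u'" using u by (simp add: harmonic_on_cell_def)
next
  fix v :: "nat list" and i j k :: nat
  assume h: "set v \<subseteq> {0,1,2} \<and> {i,j,k} = {0,1,2}"
  then have v: "set v \<subseteq> {0,1,2}" and m: "i \<in> {0,1,2}" "j \<in> {0,1,2}" "k \<in> {0,1,2}" by blast+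
  have e: "u' (wmap q (w @ v) x) = u (wmap q (w @ v) x)" if "x \<in> SG q" for x
    using eq wmap_SG[OF v that] by (simp add: cell_def)
  show "u' (wmap q (w @ v) (contr q i (q j))) = (2 * u' (wmap q (w @ v) (q i))
      + 2 * u' (wmap q (w @ v) (q j)) + u' (wmap q (w @ v) (q k))) / 5"
    using u h unfolding harmonic_on_cell_def by (simp only: e contr_SG q_SG m)
qed

lemma harmonic_extension_harmonic:
  assumes eq: "equilateral q"
  shows "harmonic_on_cell q w (harmonic_extension q w b)"
  unfolding harmonic_on_cell_def
proof (intro conjI allI impI)
  have "compact (SG q)" using is_gasket_SG[of q] by (simp add: is_gasket_def)
  then have "continuous_on (wmap q w ` SG q) (inv (wmap q w))"
    by (intro continuous_on_inv continuous_on_wmap) (auto intro!: inv_f_f injI simp: wmap_inj)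
  moreover have "inv (wmap q w) ` wmap q w ` SG q \<subseteq> SG q"
    by (auto simp: inv_f_f inj_def wmap_inj)
  ultimately have "continuous_on (wmap q w ` SG q) (\<lambda>z. hcoord q (inv (wmap q w) z))"
    using continuous_on_compose2[OF continuous_on_hcoord[OF eq]] by blast
  then show "continuous_on (cell q w) (harmonic_extension q w b)"
    unfolding cell_def harmonic_extension_def
    by (rule linear_continuous_on_compose[OF _ pairing_linear])
next
  fix v :: "nat list" and i j k :: nat assume h: "set v \<subseteq> {0,1,2} \<and> {i,j,k} = {0,1,2::nat}"
  then have m: "i \<in> {0,1,2}" "j \<in> {0,1,2}" "k \<in> {0,1,2}" by blast+
  have v: "harmonic_extension q w b (wmap q (w @ v) x) = pairing b (hword v (hcoord q x))"
    if "x \<in> SG q" for x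
    using h that by (simp add: harmonic_extension_wmap hcoord_wmap[OF eq])
  have "hcoord q (contr q i (q j)) = (1/5) *\<^sub>R (2 *\<^sub>R corner i + 2 *\<^sub>R corner j + corner k)"
    using hcoord_contr[OF eq m(1) q_SG[OF m(2)]] hcoord_vertex[OF eq m(2)] hmap_corner h by simp
  then have "pairing b (hword v (hcoord q (contr q i (q j)))) =
      (2 * pairing b (hword v (corner i)) + 2 * pairing b (hword v (corner j))
        + pairing b (hword v (corner k))) / 5"
    by (simp add: linear_cmul[OF hword_linear] linear_add[OF hword_linear]
      linear_cmul[OF pairing_linear] linear_add[OF pairing_linear])
  then show "harmonic_extension q w b (wmap q (w @ v) (contr q i (q j))) =
      (2 * harmonic_extension q w b (wmap q (w @ v) (q i))
        + 2 * harmonic_extension q w b (wmap q (w @ v) (q j))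
        + harmonic_extension q w b (wmap q (w @ v) (q k))) / 5"
    by (simp only: v contr_SG q_SG m hcoord_vertex[OF eq])
qed

text \<open>The rule determines \<open>u\<close> at every \<open>F\<^sub>wF\<^sub>vq\<^sub>i\<close> by induction on the length of \<open>v\<close>; density and continuity
  do the rest.\<close>

lemma harmonic_unique:
  assumes "harmonic_on_cell q w u" "harmonic_on_cell q w u'"
    and corners: "\<And>i. i \<in> {0,1,2} \<Longrightarrow> u (wmap q w (q i)) = u' (wmap q w (q i))"
    and z: "z \<in> cell q w"
  shows "u z = u' z"
proof -
  have *: "\<forall>i\<in>{0,1,2}. u (wmap q (w @ v) (q i)) = u' (wmap q (w @ v) (q i))"
    if "set v \<subseteq> {0,1,2}" for v
    using that
  proof (induction v rule: rev_induct)
    case Nil then show ?case using corners by simp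
  next
    case (snoc j v)
    then have IH: "\<forall>i\<in>{0,1,2}. u (wmap q (w @ v) (q i)) = u' (wmap q (w @ v) (q i))"
      and v: "set v \<subseteq> {0,1,2}" and j: "j \<in> {0,1,2}" by auto
    show ?case
    proof
      fix i :: nat assume i: "i \<in> {0,1,2}"
      show "u (wmap q (w @ v @ [j]) (q i)) = u' (wmap q (w @ v @ [j]) (q i))"
      proof (cases "i = j")
        case True
        then have "wmap q (w @ v @ [j]) (q i) = wmap q (w @ v) (q j)" by (simp add: contr_vertex)
        then show ?thesis using bspec[OF IH j] by (simp only:)
      next
        case False
        \<comment> \<open>The third index, as the three indices sum to \<open>3\<close>.\<close>
        define k where "k = 3 - i - j"
        have k: "{j,i,k} = {0,1,2}" using i j False by (auto simp: k_def)
        have kk: "k \<in> {0,1,2}" using k by blast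
        have "u (wmap q (w @ v) (contr q j (q i))) = u' (wmap q (w @ v) (contr q j (q i)))"
          using assms(1,2) v k IH i j kk unfolding harmonic_on_cell_def by metis
        then show ?thesis by simp
      qed
    qed
  qed
  obtain x where x: "x \<in> SG q" "z = wmap q w x" using z by (auto simp: cell_def)
  have c: "continuous_on (SG q) (\<lambda>x. f (wmap q w x))" if "harmonic_on_cell q w f" for f
  proof (rule continuous_on_compose2[of "cell q w" f])
    show "continuous_on (cell q w) f" using that by (simp add: harmonic_on_cell_def)
  qed (auto simp: cell_def intro: continuous_on_wmap)
  have "SG q \<subseteq> {x \<in> SG q. u (wmap q w x) - u' (wmap q w x) = 0}"
  proof (rule SG_subset_closed)
    have "closed (SG q)" using is_gasket_SG[of q] by (simp add: is_gasket_def compact_imp_closed)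
    then show "closed {x \<in> SG q. u (wmap q w x) - u' (wmap q w x) = 0}"
      by (intro continuous_closed_preimage_constant continuous_intros c assms(1,2))
    show "wmap q v (q i) \<in> {x \<in> SG q. u (wmap q w x) - u' (wmap q w x) = 0}"
      if "set v \<subseteq> {0,1,2}" "i \<in> {0,1,2}" for v i
      using *[OF that(1)] wmap_SG[OF that(1) q_SG[OF that(2)]] that(2) by auto
  qed
  then have "u (wmap q w x) - u' (wmap q w x) = 0" using x(1) by blast
  then show ?thesis using x(2) by simp
qed

section \<open>Geometry of the cells of the half gasket\<close>

lemma wmap_Yword: "wmap q (Yword m) x = (contr q 0 ^^ (m - 1)) (contr q 1 x)"
proof -
  have "wmap q (replicate n 0) y = (contr q 0 ^^ n) y" for n y
    by (induction n) simp_all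
  then show ?thesis by (simp add: Yword_def)
qed

text \<open>The junction identities \<open>F\<^sub>1q\<^sub>0 = F\<^sub>0q\<^sub>1\<close> and \<open>F\<^sub>1q\<^sub>2 = F\<^sub>2q\<^sub>1\<close> turn the corners of \<open>F\<^sub>0\<^sup>m\<^sup>-\<^sup>1F\<^sub>1SG\<close> into the
  points \<open>y\<^sub>m\<close> and \<open>x\<^sub>m\<close>.\<close>

lemma Yword_corners:
  assumes "m \<ge> 1"
  shows "wmap q (Yword m) (q 0) = ypt q m"
    and "wmap q (Yword m) (q 1) = ypt q (m - 1)"
    and "wmap q (Yword m) (q 2) = xpt q m"
proof -
  obtain n where m: "m = Suc n" using assms by (cases m) auto
  show "wmap q (Yword m) (q 0) = ypt q m"
    by (simp add: wmap_Yword ypt_def m contr_commute[of q "Suc 0" 0] flip: funpow_Suc_right del: funpow.simps)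
      (simp add: funpow_swap1)
  show "wmap q (Yword m) (q 1) = ypt q (m - 1)" by (simp add: wmap_Yword ypt_def contr_vertex)
  show "wmap q (Yword m) (q 2) = xpt q m" by (simp add: wmap_Yword xpt_def contr_commute[of q "Suc 0" 2])
qed

lemma corner_in_cell: "i \<in> {0,1,2} \<Longrightarrow> wmap q w (q i) \<in> cell q w"
  by (simp add: cell_def q_SG)

text \<open>The height \<open>1 - \<beta>\<^sub>0\<close> above \<open>q\<^sub>0\<close> is halved by \<open>F\<^sub>0\<close>, and \<open>F\<^sub>1\<close> brings it to \<open>1 - \<beta>\<^sub>0/2\<close>.\<close>

lemma height_Yword:
  assumes "equilateral q" "m \<ge> 1"
  shows "1 - bary q 0 (wmap q (Yword m) x) = (1/2)^(m-1) * (1 - bary q 0 x / 2)"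
proof -
  have "1 - bary q 0 ((contr q 0 ^^ n) y) = (1/2)^n * (1 - bary q 0 y)" for n y
    by (induction n) (simp_all add: bary_contr[OF assms(1)] field_simps)
  then show ?thesis by (simp add: wmap_Yword bary_contr[OF assms(1)])
qed

lemma height_cell:
  assumes "equilateral q" "m \<ge> 1" "z \<in> cell q (Yword m)"
  shows "(1/2)^m \<le> 1 - bary q 0 z" "1 - bary q 0 z \<le> (1/2)^(m-1)"
    and "1 - bary q 0 z = (1/2)^m \<Longrightarrow> z = ypt q m"
proof -
  obtain x where x: "x \<in> SG q" "z = wmap q (Yword m) x" using assms(3) by (auto simp: cell_def)
  have h: "1 - bary q 0 z = (1/2)^(m-1) * (1 - bary q 0 x / 2)"
    using height_Yword[OF assms(1,2)] x(2) by simp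
  have b: "0 \<le> bary q 0 x" "bary q 0 x \<le> 1" "bary q 0 x = 1 \<Longrightarrow> x = q 0"
    using bary_SG[OF assms(1) _ x(1), of 0] by auto
  have p: "(1/2::real)^m = (1/2)^(m-1) * (1/2)" using assms(2) by (cases m) auto
  show "(1/2)^m \<le> 1 - bary q 0 z" unfolding h p using b by (intro mult_left_mono) auto
  show "1 - bary q 0 z \<le> (1/2)^(m-1)" unfolding h using b by (simp add: mult_left_le)
  assume "1 - bary q 0 z = (1/2)^m"
  then have "bary q 0 x = 1" unfolding h p by simp
  then have "x = q 0" by (rule b(3))
  then show "z = ypt q m" using x(2) Yword_corners(1)[OF assms(2)] by simp
qed

lemma cells_meet:
  assumes "equilateral q" "1 \<le> m" "m < n" "z \<in> cell q (Yword m)" "z \<in> cell q (Yword n)"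
  shows "n = Suc m \<and> z = ypt q m"
proof -
  have l: "(1/2)^m \<le> 1 - bary q 0 z" and u: "1 - bary q 0 z \<le> (1/2)^(n-1)"
    using height_cell[OF assms(1)] assms by auto
  have "(1/2::real)^(n-1) \<le> (1/2)^m" using assms(3) by (intro power_decreasing) auto
  then have e: "1 - bary q 0 z = (1/2)^m" "(1/2::real)^(n-1) = (1/2)^m" using l u by linarith+
  then have "n - 1 = m" by (simp add: power_inject_exp')
  then show ?thesis using assms(3) height_cell(3)[OF assms(1,2,4) e(1)] by simp
qed

lemma punctured_domain:
  assumes "equilateral q"
  shows "Omega_closure q - {q 0} = (\<Union>m\<in>{1..}. cell q (Yword m))"
proof -
  have "q 0 \<notin> cell q (Yword m)" if "m \<ge> 1" for m
  proof
    assume "q 0 \<in> cell q (Yword m)"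
    from height_cell(1)[OF assms that this] show False
      by (simp add: bary_vertex[OF assms]) (metis not_le zero_less_power half_gt_zero_iff zero_less_one)
  qed
  then show ?thesis by (auto simp: Omega_closure_def)
qed

text \<open>The sets of points with height above \<open>2\<^sup>-\<^sup>N\<close> are open, cover the domain, and meet only the first \<open>N\<close>
  cells; on a finite union of closed sets continuity may be checked piecewise.\<close>

lemma continuous_on_punctured_domain:
  fixes u :: "real^2 \<Rightarrow> real"
  assumes eq: "equilateral q" and c: "\<And>m. m \<ge> 1 \<Longrightarrow> continuous_on (cell q (Yword m)) u"
  shows "continuous_on (Omega_closure q - {q 0}) u"
proof -
  define U where "U N = {z. (1/2)^N < 1 - bary q 0 z}" for N :: nat
  have oU: "open (U N)" for N
    unfolding U_def bary_def by (intro open_Collect_less continuous_intros)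
  have K: "compact (SG q)" using is_gasket_SG[of q] by (simp add: is_gasket_def)
  define D where "D = Omega_closure q - {q 0}"
  have D: "D = (\<Union>m\<in>{1..}. cell q (Yword m))" unfolding D_def by (rule punctured_domain[OF eq])
  have cU: "continuous_on (D \<inter> U N) u" for N
  proof (rule continuous_on_subset)
    show "continuous_on (\<Union>m\<in>{1..N}. cell q (Yword m)) u"
    proof (rule continuous_on_closed_Union)
      show "closed (cell q (Yword m))" for m
        unfolding cell_def
        by (intro compact_imp_closed compact_continuous_image continuous_on_wmap K)
    qed (use c in auto)
    show "D \<inter> U N \<subseteq> (\<Union>m\<in>{1..N}. cell q (Yword m))"
    proof
      fix z assume z: "z \<in> D \<inter> U N"
      then obtain m where m: "m \<ge> 1" "z \<in> cell q (Yword m)" unfolding D by auto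
      have "(1/2)^N < 1 - bary q 0 z" using z by (simp add: U_def)
      then have "(1/2::real)^N < (1/2)^(m-1)" using height_cell(2)[OF eq m] by (rule less_le_trans)
      then have "m - 1 < N" by simp
      then show "z \<in> (\<Union>m\<in>{1..N}. cell q (Yword m))" using m by auto
    qed
  qed
  have "continuous (at z within D) u" if z: "z \<in> D" for z
  proof -
    obtain m where m: "m \<ge> 1" "z \<in> cell q (Yword m)" using z unfolding D by auto
    have "(1/2::real)^(Suc m) < (1/2)^m" by simp
    also have "\<dots> \<le> 1 - bary q 0 z" by (rule height_cell(1)[OF eq m])
    finally have "z \<in> U (Suc m)" unfolding U_def by (rule CollectI)
    then have "at z within D = at z within (D \<inter> U (Suc m))"
      by (intro at_within_nhd[OF _ oU]) auto
    then show ?thesis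
      using cU[of "Suc m"] z \<open>z \<in> U (Suc m)\<close> by (simp add: continuous_on_eq_continuous_within)
  qed
  then show ?thesis unfolding D_def[symmetric] by (simp add: continuous_on_eq_continuous_within)
qed

section \<open>The recurrence for the junction values\<close>

text \<open>The closed formula gives \<open>a\<^sub>0 + a\<^sub>1\<close> at \<open>m = 0\<close>, not \<open>a\<^sub>0\<close>: both sums are
  then empty, whereas continuing the recurrence backwards from \<open>m = 1\<close> would subtract a term \<open>k = 1\<close>
  from each. Hence the separate case.\<close>

definition junction_value :: "(nat \<Rightarrow> real) \<Rightarrow> real \<Rightarrow> nat \<Rightarrow> real" where
  "junction_value a l m = (if m = 0 then a 0 else 3^m * Fcoef a m l + 1 / 5^m * Gcoef a m l)"

lemma junction_value_1: "junction_value a l 1 = l"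
  by (simp add: junction_value_def Fcoef_def Gcoef_def field_simps)

text \<open>Dividing the matching condition by \<open>(5/3)\<^sup>m / 3\<close> leaves the weights \<open>3\<close> and \<open>5\<close>.\<close>

lemma matching_iff:
  fixes m :: nat and y y' y'' c c' :: real
  shows "(5/3)^m * (2 * y - y' - c) + (5/3)^(m+1) * (2 * y - y'' - c') = 0
    \<longleftrightarrow> y'' = (16 * y - 3 * y' - 3 * c - 5 * c') / 5"
    (is "?L = 0 \<longleftrightarrow> _")
proof -
  define r where "r = (5/3 :: real)^m"
  have "r * (2 * y - y' - c) + r * (5/3) * (2 * y - y'' - c') =
      r / 3 * (16 * y - 3 * y' - 3 * c - 5 * c' - 5 * y'')"
    by (simp add: field_simps)
  moreover have "(5/3 :: real)^(m+1) = r * (5/3)" by (simp add: r_def)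
  ultimately have "?L =
      r / 3 * (16 * y - 3 * y' - 3 * c - 5 * c' - 5 * y'')"
    by (simp only: r_def[symmetric])
  moreover have "r \<noteq> 0" by (simp add: r_def)
  ultimately have "?L = 0 \<longleftrightarrow> 16 * y - 3 * y' - 3 * c - 5 * c' - 5 * y'' = 0"
    by (simp only:) simp
  then show ?thesis by (simp only:) auto
qed

text \<open>Both \<open>3\<^sup>m\<close> and \<open>5\<^sup>-\<^sup>m\<close> solve the homogeneous recurrence, so the contributions of \<open>F\<^sub>n\<close> and \<open>G\<^sub>n\<close> cancel and
  only the last two terms of the sums are left to balance \<open>a\<^sub>m\<close> and \<open>a\<^bsub>m+1\<^esub>\<close>. At \<open>m = 1\<close> the exceptional
  value at \<open>0\<close> enters, so that case is computed directly.\<close>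

lemma junction_value_rec:
  assumes "m \<ge> 1"
  shows "junction_value a l (m+1) =
    (16 * junction_value a l m - 3 * junction_value a l (m-1) - 3 * a m - 5 * a (m+1)) / 5"
proof (cases "m = 1")
  case True
  then show ?thesis
    by (simp add: junction_value_def Fcoef_def Gcoef_def numeral_2_eq_2 field_simps)
next
  case False
  then obtain n where m: "m = Suc n" "n \<ge> 1" using assms by (cases m) auto
  define A where "A = 5 * l - a 0 - a 1 - 18 * (\<Sum>k=2..n. 1 / 3^k * a k)"
  define B where "B = - 5 * l + 15 * a 0 + 15 * a 1 + 4 * (\<Sum>k=2..n. 5^k * a k)"
  define s where "s = (3::real)^n"
  define t where "t = (5::real)^n"
  have st: "s > 0" "t > 0" by (auto simp: s_def t_def)
  have F: "Fcoef a n l = 1/14 * A"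
    "Fcoef a (Suc n) l = 1/14 * (A - 18 * a (Suc n) / (3 * s))"
    "Fcoef a (Suc (Suc n)) l = 1/14 * (A - 18 * a (Suc n) / (3 * s) - 18 * a (Suc (Suc n)) / (9 * s))"
    using m(2) by (simp_all add: Fcoef_def A_def s_def)
  have G: "Gcoef a n l = 1/14 * B"
    "Gcoef a (Suc n) l = 1/14 * (B + 20 * t * a (Suc n))"
    "Gcoef a (Suc (Suc n)) l = 1/14 * (B + 20 * t * a (Suc n) + 100 * t * a (Suc (Suc n)))"
    using m(2) by (simp_all add: Gcoef_def B_def t_def algebra_simps)
  have J: "junction_value a l n = s * (1/14 * A) + 1/14 * B / t"
    "junction_value a l (Suc n) = 3 * s * (1/14 * (A - 18 * a (Suc n) / (3 * s)))
        + 1/14 * (B + 20 * t * a (Suc n)) / (5 * t)"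
    "junction_value a l (Suc (Suc n)) =
        9 * s * (1/14 * (A - 18 * a (Suc n) / (3 * s) - 18 * a (Suc (Suc n)) / (9 * s)))
        + 1/14 * (B + 20 * t * a (Suc n) + 100 * t * a (Suc (Suc n))) / (25 * t)"
    using m(2) by (simp_all add: junction_value_def F G flip: s_def t_def)
  have "junction_value a l (Suc (Suc n)) = (16 * junction_value a l (Suc n)
      - 3 * junction_value a l n - 3 * a (Suc n) - 5 * a (Suc (Suc n))) / 5"
    unfolding J using st by (simp add: field_simps)
  then show ?thesis by (simp add: m)
qed

lemma junction_value_unique:
  assumes "y 0 = a 0"
    and "\<And>m. m \<ge> 1 \<Longrightarrow> y (m+1) = (16 * y m - 3 * y (m-1) - 3 * a m - 5 * a (m+1)) / 5"
  shows "y m = junction_value a (y 1) m"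
proof (induction m rule: less_induct)
  case (less m)
  consider "m = 0" | "m = 1" | n where "m = n + 1" "n \<ge> 1"
    by (metis One_nat_def Suc_eq_plus1 less_one not_less old.nat.exhaust)
  then show ?case
  proof cases
    case 1 then show ?thesis using assms(1) by (simp add: junction_value_def)
  next
    case 2 then show ?thesis by (simp add: junction_value_1[unfolded One_nat_def])
  next
    case 3
    then have "y n = junction_value a (y 1) n" "y (n-1) = junction_value a (y 1) (n-1)"
      using less.IH[of n] less.IH[of "n - 1"] by simp_all
    then show ?thesis using 3 assms(2)[OF 3(2)] junction_value_rec[OF 3(2), of a "y 1"] by simp
  qed
qed

lemma junction_value_affine:
  "junction_value a ((1 - t) * l + t * l') m =
    (1 - t) * junction_value a l m + t * junction_value a l' m"
  by (simp add: junction_value_def Fcoef_def Gcoef_def field_simps)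

section \<open>The solution family\<close>

text \<open>The corner values on \<open>Y\<^sub>m\<close>, in the corner order of \<open>Yword_corners\<close>.\<close>

definition cell_data :: "(nat \<Rightarrow> real) \<Rightarrow> real \<Rightarrow> nat \<Rightarrow> nat \<Rightarrow> real" where
  "cell_data a l m i = (if i = 0 then junction_value a l m
     else if i = 1 then junction_value a l (m - 1) else a m)"

text \<open>On a point \<open>y\<^sub>m\<close> of two cells the smaller index is used; \<open>solution_on_cell\<close> shows that the choice
  does not matter.\<close>

definition solution :: "(nat \<Rightarrow> real^2) \<Rightarrow> (nat \<Rightarrow> real) \<Rightarrow> real \<Rightarrow> real^2 \<Rightarrow> real" where
  "solution q a l = restrict
     (\<lambda>z. let m = (LEAST m. m \<ge> 1 \<and> z \<in> cell q (Yword m))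
          in harmonic_extension q (Yword m) (cell_data a l m) z)
     (Omega_closure q - {q 0})"

text \<open>Two cells share at most \<open>y\<^sub>n\<close>, a corner of both, and both prescribe the same value there.\<close>

lemma solution_on_cell:
  assumes eq: "equilateral q" and m: "m \<ge> 1" "z \<in> cell q (Yword m)"
  shows "solution q a l z = harmonic_extension q (Yword m) (cell_data a l m) z"
proof -
  define n where "n = (LEAST m. m \<ge> 1 \<and> z \<in> cell q (Yword m))"
  have n: "n \<ge> 1" "z \<in> cell q (Yword n)"
    using LeastI[of "\<lambda>m. m \<ge> 1 \<and> z \<in> cell q (Yword m)" m] m by (auto simp: n_def)
  have "n \<le> m" unfolding n_def by (rule Least_le) (use m in auto)
  have "z \<in> Omega_closure q - {q 0}" using punctured_domain[OF eq] m by auto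
  then have s: "solution q a l z = harmonic_extension q (Yword n) (cell_data a l n) z"
    by (simp add: solution_def n_def Let_def)
  show ?thesis
  proof (cases "n = m")
    case False
    then have e: "m = Suc n" "z = ypt q n" using cells_meet[OF eq n(1) _ n(2) m(2)] \<open>n \<le> m\<close> by auto
    have "harmonic_extension q (Yword n) (cell_data a l n) z = junction_value a l n"
      using harmonic_extension_corner[OF eq, of 0 "Yword n" "cell_data a l n"] e Yword_corners(1)[OF n(1)]
      by (simp add: cell_data_def)
    moreover have "harmonic_extension q (Yword m) (cell_data a l m) z = junction_value a l n"
      using harmonic_extension_corner[OF eq, of 1 "Yword m" "cell_data a l m"] e Yword_corners(2)[OF m(1)]
      by (simp add: cell_data_def)
    ultimately show ?thesis using s by simp
  qed (use s in simp)
qed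

lemma solution_corner:
  assumes "equilateral q" "m \<ge> 1" "i \<in> {0,1,2}"
  shows "solution q a l (wmap q (Yword m) (q i)) = cell_data a l m i"
  using solution_on_cell[OF assms(1,2) corner_in_cell[OF assms(3)]]
    harmonic_extension_corner[OF assms(1,3)] by simp

lemma solution_x: "equilateral q \<Longrightarrow> m \<ge> 1 \<Longrightarrow> solution q a l (xpt q m) = a m"
  using solution_corner[of q m 2 a l] Yword_corners(3)[of m q] by (simp add: cell_data_def)

lemma solution_y: "equilateral q \<Longrightarrow> solution q a l (ypt q m) = junction_value a l m"
  using solution_corner[of q "Suc m" 1 a l] Yword_corners(2)[of "Suc m" q]
  by (simp add: cell_data_def)

lemma solution_harmonic:
  assumes "equilateral q" "m \<ge> 1"
  shows "harmonic_on_cell q (Yword m) (solution q a l)"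
  by (rule harmonic_on_cell_cong[OF harmonic_extension_harmonic solution_on_cell]) (use assms in auto)

lemma ypt_0: "ypt q 0 = q 1"
  by (simp add: ypt_def)

lemma solution_in_solutions:
  assumes eq: "equilateral q"
  shows "solution q a l \<in> solutions q a"
  unfolding solutions_def
proof (intro CollectI conjI allI impI)
  show "solution q a l \<in> extensional (Omega_closure q - {q 0})"
    unfolding solution_def by (rule restrict_extensional)
  show "continuous_on (Omega_closure q - {q 0}) (solution q a l)"
    using solution_harmonic[OF eq]
    by (intro continuous_on_punctured_domain[OF eq]) (simp add: harmonic_on_cell_def)
  show "Laplace_zero q (solution q a l)"
    unfolding Laplace_zero_def matching_iff
    using solution_harmonic[OF eq] junction_value_rec by (simp add: solution_y[OF eq] solution_x[OF eq])
  show "solution q a l (q 1) = a 0"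
    using solution_y[OF eq, of a l 0] by (simp add: ypt_0 junction_value_def)
qed (rule solution_x[OF eq])

text \<open>The matching conditions give the values of a solution at all \<open>y\<^sub>m\<close>, hence at all corners of each cell,
  and harmonic functions are determined by their corner values.\<close>

lemma solutions_are_solution:
  assumes eq: "equilateral q" and v: "v \<in> solutions q a"
  shows "v = solution q a (v (ypt q 1))"
proof (rule extensionalityI)
  show "v \<in> extensional (Omega_closure q - {q 0})" using v by (simp add: solutions_def)
  show "solution q a (v (ypt q 1)) \<in> extensional (Omega_closure q - {q 0})"
    unfolding solution_def by (rule restrict_extensional)
  have vx: "v (xpt q m) = a m" if "m \<ge> 1" for m using v that by (simp add: solutions_def)
  have L: "Laplace_zero q v" using v by (simp add: solutions_def)
  have vy: "v (ypt q m) = junction_value a (v (ypt q 1)) m" for m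
  proof (rule junction_value_unique[of "\<lambda>m. v (ypt q m)"])
    show "v (ypt q 0) = a 0" using v by (simp add: solutions_def ypt_0)
    fix m :: nat assume m: "m \<ge> 1"
    then show "v (ypt q (m+1)) =
        (16 * v (ypt q m) - 3 * v (ypt q (m-1)) - 3 * a m - 5 * a (m+1)) / 5"
      using L unfolding Laplace_zero_def matching_iff by (simp add: vx)
  qed
  fix z assume "z \<in> Omega_closure q - {q 0}"
  then obtain m where m: "m \<ge> 1" "z \<in> cell q (Yword m)" using punctured_domain[OF eq] by auto
  show "v z = solution q a (v (ypt q 1)) z"
  proof (rule harmonic_unique[OF _ solution_harmonic[OF eq m(1)] _ m(2)])
    show "harmonic_on_cell q (Yword m) v" using L m(1) by (simp add: Laplace_zero_def)
    fix i :: nat assume "i \<in> {0,1,2}"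
    then consider "i = 0" | "i = 1" | "i = 2" by blast
    then show "v (wmap q (Yword m) (q i)) = solution q a (v (ypt q 1)) (wmap q (Yword m) (q i))"
      by cases (simp_all only: Yword_corners[OF m(1)] vx[OF m(1)] solution_x[OF eq m(1)]
        solution_y[OF eq] vy[symmetric])
  qed
qed

text \<open>The corner values depend on the parameter affinely, and harmonic extension is linear in them.\<close>

lemma solution_affine:
  assumes eq: "equilateral q" and "z \<in> Omega_closure q - {q 0}"
  shows "solution q a ((1 - t) * l + t * l') z = (1 - t) * solution q a l z + t * solution q a l' z"
proof -
  obtain m where m: "m \<ge> 1" "z \<in> cell q (Yword m)"
    using assms(2) punctured_domain[OF eq] by auto
  show ?thesis unfolding solution_on_cell[OF eq m]
    by (rule harmonic_extension_affine)
      (simp add: cell_data_def junction_value_affine, simp add: algebra_simps)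
qed

theorem theorem2p2:
  fixes q :: "nat \<Rightarrow> real^2" and a :: "nat \<Rightarrow> real"
  assumes "equilateral q" and "convergent a"
  shows "\<exists>u :: real \<Rightarrow> real^2 \<Rightarrow> real.
    bij_betw u UNIV (solutions q a) \<and>
    (\<forall>l l' t. \<forall>z \<in> Omega_closure q - {q 0}.
       u ((1 - t) * l + t * l') z = (1 - t) * u l z + t * u l' z) \<and>
    (\<forall>l. (\<forall>m\<ge>1. harmonic_on_cell q (Yword m) (u l)) \<and>
         u l (q 1) = a 0 \<and> (\<forall>m\<ge>1. u l (xpt q m) = a m) \<and> u l (ypt q 1) = l \<and>
         (\<forall>m\<ge>1. u l (ypt q m) = 3^m * Fcoef a m l + 1 / 5^m * Gcoef a m l))"
proof (intro exI[of _ "solution q a"] conjI allI ballI impI)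
  note eq = assms(1)
  have y1: "solution q a l (ypt q 1) = l" for l
    unfolding solution_y[OF eq] by (rule junction_value_1)
  show "bij_betw (solution q a) UNIV (solutions q a)"
    unfolding bij_betw_def
  proof
    show "inj (solution q a)" by (rule injI) (metis y1)
    show "range (solution q a) = solutions q a"
      using solution_in_solutions[OF eq] solutions_are_solution[OF eq] by blast
  qed
  show "solution q a l (ypt q 1) = l" for l by (rule y1)
  show "solution q a l (q 1) = a 0" for l
    using solution_y[OF eq, of a l 0] by (simp add: ypt_0 junction_value_def)
  show "solution q a l (ypt q m) = 3^m * Fcoef a m l + 1 / 5^m * Gcoef a m l" if "1 \<le> m" for l m
    using that by (simp add: solution_y[OF eq] junction_value_def)
qed (use assms(1) solution_affine solution_harmonic solution_x in auto)

end
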